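(* Let $d \ge 2$ be an integer. For an integer $H \ge 1$, let $F_d(H)$ denote the number of polynomials $f(X) = a_dX^d + a_{d-1}X^{d-1} + \dots + a_1X + a_0 \in \mathbb{Z}[X]$ (not necessarily monic) with $\max\{|a_0|,\ldots,|a_{d}|\} \le H$ which are Eisenstein polynomials. Then, as $H \to \infty$, $$ F_d(H)=\rho_d 2^{d+1} H^{d+1}+\begin{cases} O\left(H^{d}\right),& \text{if } d>2, \\ O\left(H^2(\log H)^2\right),& \text{if } d=2, \end{cases} $$ where $$ \rho_d = 1-\prod_{p \text{ prime}}\left(1- \frac{(p-1)^2}{p^{d+2}}\right), $$ and the implied constants may depend on $d$.
   Context: A polynomial $f(X) = a_dX^d + a_{d-1}X^{d-1} + \dots + a_1X + a_0 \in \mathbb{Z}[X]$ is called an Eisenstein polynomial if there exists a prime $p$ such that (i) $p \mid a_i$ for $i = 0,\ldots,d-1$, (ii) $p^2 \nmid a_0$, and (iii) $p \nmid a_d$. The notation $U = O(V)$ means $|U| \le c|V|$ for some constant $c>0$. *)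

theory Defs
  imports "HOL-Analysis.Analysis" "HOL-Computational_Algebra.Computational_Algebra"
    "HOL-Library.Landau_Symbols"
begin

definition eisenstein :: "int poly \<Rightarrow> bool" where
  "eisenstein f \<longleftrightarrow> (\<exists>p::int. prime p \<and> (\<forall>i<degree f. p dvd coeff f i)
     \<and> \<not> p ^ 2 dvd coeff f 0 \<and> \<not> p dvd lead_coeff f)"

(* The leading coefficient of an Eisenstein polynomial is nonzero, so a polynomial written with
   formal degree d counts here only if its actual degree is d. *)
definition eisenstein_polys :: "nat \<Rightarrow> nat \<Rightarrow> int poly set" where
  "eisenstein_polys d H =
     {f. degree f = d \<and> (\<forall>i\<le>d. \<bar>coeff f i\<bar> \<le> int H) \<and> eisenstein f}"

definition eisenstein_count :: "nat \<Rightarrow> nat \<Rightarrow> nat" where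
  "eisenstein_count d H = card (eisenstein_polys d H)"

(* The product over primes is a product over all naturals with trivial non-prime factors. *)
definition euler_factor :: "nat \<Rightarrow> nat \<Rightarrow> real" where
  "euler_factor d p =
     (if prime p then 1 - (real p - 1) ^ 2 / real p ^ (d + 2) else 1)"

definition rho :: "nat \<Rightarrow> real" where
  "rho d = 1 - (\<Prod>p. euler_factor d p)"

lemma finite_eisenstein_polys: "finite (eisenstein_polys d H)"
proof (rule finite_subset)
  show "eisenstein_polys d H \<subseteq>
          Poly ` {xs. set xs \<subseteq> {- int H..int H} \<and> length xs \<le> Suc d}"
  proof
    fix f assume f: "f \<in> eisenstein_polys d H"
    have "set (coeffs f) \<subseteq> {- int H..int H}"
    proof
      fix x assume "x \<in> set (coeffs f)"
      then obtain i where i: "i < length (coeffs f)" "x = coeffs f ! i"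
        by (metis in_set_conv_nth)
      then have "f \<noteq> 0" by auto
      with i have "i \<le> degree f" "x = coeff f i"
        by (simp_all add: length_coeffs_degree coeffs_nth)
      with f have "\<bar>x\<bar> \<le> int H" by (auto simp: eisenstein_polys_def)
      then show "x \<in> {- int H..int H}" by auto
    qed
    moreover have "length (coeffs f) \<le> Suc d"
      using f by (auto simp: eisenstein_polys_def coeffs_def)
    ultimately show "f \<in> Poly ` {xs. set xs \<subseteq> {- int H..int H} \<and> length xs \<le> Suc d}"
      by (intro image_eqI[of _ _ "coeffs f"]) auto
  qed
  show "finite (Poly ` {xs. set xs \<subseteq> {- int H..int H} \<and> length xs \<le> Suc d})"
    by (intro finite_imageI finite_lists_length_le) auto
qed

lemma convergent_prod_euler_factor:
  assumes "d \<ge> 2"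
  shows "convergent_prod (euler_factor d)"
proof (rule abs_convergent_prod_imp_convergent_prod)
  have bound: "norm (euler_factor d p - 1) \<le> inverse (real p ^ 2)" for p
  proof (cases "prime p")
    case True
    then have p: "real p \<ge> 1" using prime_ge_1_nat by force
    have "(real p - 1) ^ 2 \<le> real p ^ 2" using p by (intro power_mono) auto
    also have "\<dots> \<le> real p ^ d" using p assms by (intro power_increasing) auto
    finally have le: "(real p - 1) ^ 2 \<le> real p ^ d" .
    have "norm (euler_factor d p - 1) = (real p - 1) ^ 2 / real p ^ (d + 2)"
      using True by (simp add: euler_factor_def)
    also have "\<dots> \<le> real p ^ d / real p ^ (d + 2)"
      using le by (intro divide_right_mono) auto
    also have "\<dots> = inverse (real p ^ 2)"
    proof -
      have "real p ^ d \<noteq> 0" using p by auto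
      then show ?thesis
        unfolding power_add inverse_eq_divide by (rule nonzero_divide_mult_cancel_left)
    qed
    finally show ?thesis .
  qed (simp add: euler_factor_def)
  have "summable (\<lambda>p. inverse (real p ^ 2))"
    by (rule inverse_power_summable) simp
  then have "summable (\<lambda>p. norm (euler_factor d p - 1))"
  proof (rule summable_comparison_test')
    show "norm (norm (euler_factor d p - 1)) \<le> inverse (real p ^ 2)" if "p \<ge> 0" for p
      using bound[of p] by (simp only: real_norm_def abs_abs)
  qed
  then show "abs_convergent_prod (euler_factor d)"
    by (rule summable_imp_abs_convergent_prod)
qed

end

theory Submission
  imports Defs
begin

text \<open>
  An Eisenstein prime of a polynomial of height at most \<open>H\<close> divides its nonzero constant term, hence
  is at most \<open>H\<close>, so inclusion-exclusion over the sets \<open>T\<close> of primes up to \<open>H\<close> applies. With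
  \<open>s = \<Prod>T\<close>, the polynomials that are Eisenstein at every prime of \<open>T\<close> form a box of independent
  coefficient conditions; sieving by \<open>T\<close> counts them as
  \<open>2 ^ (d + 1) * H ^ (d + 1) * (\<Prod>p\<in>T. (p - 1)\<^sup>2 / p ^ (d + 2))\<close> up to \<open>O(2 ^ card T * H ^ d / s ^ (d - 1))\<close>,
  and there are none if \<open>s > H\<close>. The main terms add up to the Euler product truncated at \<open>H\<close>.
  For \<open>d = 2\<close> summing \<open>2 ^ card T / s\<close> over \<open>s \<le> H\<close> is what produces the factor \<open>(ln H)\<^sup>2\<close>.
\<close>

section \<open>Sieving an interval by finitely many primes\<close>

text \<open>The bound \<open>X\<close> is real because sieving and rescaling replace it by quotients
  such as \<open>X / p\<close>. For nonempty \<open>T\<close> the integer 0 is excluded, since every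
  prime divides it.\<close>

definition sifted :: "nat set \<Rightarrow> real \<Rightarrow> int set" where
  "sifted T X = {m. \<bar>real_of_int m\<bar> \<le> X \<and> (\<forall>p\<in>T. \<not> int p dvd m)}"

lemma sifted_empty_eq: "sifted {} X = {- \<lfloor>X\<rfloor>..\<lfloor>X\<rfloor>}"
  by (auto simp: sifted_def abs_le_iff le_floor_iff) linarith+

lemma sifted_mono: "S \<subseteq> T \<Longrightarrow> sifted T X \<subseteq> sifted S X"
  by (auto simp: sifted_def)

lemma finite_sifted [simp]: "finite (sifted T X)"
  using sifted_mono[of "{}" T X] by (simp add: sifted_empty_eq finite_subset)

lemma card_sifted_empty:
  assumes "X \<ge> 0"
  shows "\<bar>real (card (sifted {} X)) - 2 * X\<bar> \<le> 1"
proof -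
  have "real (card (sifted {} X)) = 2 * \<lfloor>X\<rfloor> + 1"
    using assms by (simp add: sifted_empty_eq)
  then show ?thesis
    by linarith
qed

text \<open>One step of Legendre's sieve. Since \<open>p\<close> is coprime to every prime in
  \<open>T\<close>, multiplication by \<open>p\<close> preserves the conditions from
  \<open>T\<close>, so the multiples of \<open>p\<close> to be removed form a sifted set at scale
  \<open>X / p\<close>. The inclusion is what turns the set difference into a difference of
  cardinalities.\<close>

lemma sifted_insert:
  assumes T: "\<And>q. q \<in> T \<Longrightarrow> prime q" and p: "prime p" "p \<notin> T"
  shows "sifted (insert p T) X = sifted T X - (\<lambda>m. int p * m) ` sifted T (X / p)"
    and "(\<lambda>m. int p * m) ` sifted T (X / p) \<subseteq> sifted T X"
proof -
  have p0: "p > 0" using p by (simp add: prime_gt_0_nat)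
  have *: "int q dvd int p * m \<longleftrightarrow> int q dvd m" if "q \<in> T" for q m
  proof -
    have "coprime q p" using that T p by (intro primes_coprime) auto
    then show ?thesis by (simp add: coprime_dvd_mult_right_iff)
  qed
  have **: "\<bar>real_of_int (int p * m)\<bar> \<le> X \<longleftrightarrow> \<bar>real_of_int m\<bar> \<le> X / p" for m
    using p0 by (simp add: abs_mult field_simps)
  have mem: "int p * m \<in> sifted T X \<longleftrightarrow> m \<in> sifted T (X / p)" for m
    using * ** by (auto simp: sifted_def)
  show "(\<lambda>m. int p * m) ` sifted T (X / p) \<subseteq> sifted T X"
    using mem by auto
  show "sifted (insert p T) X = sifted T X - (\<lambda>m. int p * m) ` sifted T (X / p)"
  proof (intro set_eqI iffI)
    fix m assume "m \<in> sifted (insert p T) X"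
    then show "m \<in> sifted T X - (\<lambda>m. int p * m) ` sifted T (X / p)"
      by (auto simp: sifted_def)
  next
    fix m assume m: "m \<in> sifted T X - (\<lambda>m. int p * m) ` sifted T (X / p)"
    then have "\<not> int p dvd m"
      using mem by (metis DiffE dvdE imageI)
    with m show "m \<in> sifted (insert p T) X"
      by (auto simp: sifted_def)
  qed
qed

text \<open>Adjoining \<open>p\<close> subtracts the count at scale \<open>X / p\<close>: the main
  term gains the factor 1 - 1/p, and the two error bounds add up to twice the old one. The induction
  therefore has to vary \<open>X\<close>.\<close>

lemma card_sifted:
  assumes "finite T" "\<And>q. q \<in> T \<Longrightarrow> prime q" "X \<ge> 0"
  shows "\<bar>real (card (sifted T X)) - 2 * X * (\<Prod>p\<in>T. 1 - 1 / real p)\<bar> \<le> 2 ^ card T"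
  using assms
proof (induction T arbitrary: X rule: finite_induct)
  case empty
  then show ?case using card_sifted_empty by simp
next
  case (insert p T)
  define g where "g = (\<Prod>p\<in>T. 1 - 1 / real p)"
  have p0: "p > 0" using insert.prems by (simp add: prime_gt_0_nat)
  have inj: "inj_on (\<lambda>m. int p * m) (sifted T (X / p))"
    using p0 by (auto simp: inj_on_def)
  note si = sifted_insert[of T p X]
  have sub: "(\<lambda>m. int p * m) ` sifted T (X / p) \<subseteq> sifted T X"
    using si insert by auto
  have "card (sifted (insert p T) X) = card (sifted T X) - card (sifted T (X / p))"
    using si insert sub by (simp add: card_Diff_subset card_image[OF inj])
  moreover have "card (sifted T (X / p)) \<le> card (sifted T X)"
    using card_mono[OF _ sub] by (simp add: card_image[OF inj])
  ultimately have "real (card (sifted (insert p T) X)) =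
      real (card (sifted T X)) - real (card (sifted T (X / p)))"
    by simp
  moreover have "\<bar>real (card (sifted T X)) - 2 * X * g\<bar> \<le> 2 ^ card T"
    unfolding g_def using insert by auto
  moreover have "\<bar>real (card (sifted T (X / p))) - 2 * (X / p) * g\<bar> \<le> 2 ^ card T"
    unfolding g_def using insert.IH[of "X / p"] insert.prems by simp
  ultimately have "\<bar>real (card (sifted (insert p T) X)) - (2 * X * g - 2 * (X / p) * g)\<bar>
      \<le> 2 * 2 ^ card T"
    by linarith
  moreover have "2 * X * g - 2 * (X / p) * g = 2 * X * (\<Prod>p\<in>insert p T. 1 - 1 / real p)"
    using insert.hyps by (simp add: g_def algebra_simps)
  ultimately show ?case
    using insert.hyps by simp
qed

section \<open>Divisibility by products of distinct primes\<close>

lemma prod_primes_dvd_iff: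
  fixes m :: int
  assumes "finite T" "\<And>q. q \<in> T \<Longrightarrow> prime q"
  shows "int (\<Prod>T) dvd m \<longleftrightarrow> (\<forall>p\<in>T. int p dvd m)"
  using assms
proof (induction T rule: finite_induct)
  case (insert p T)
  have "coprime p (\<Prod>T)"
    using insert by (intro prod_coprime_right primes_coprime) auto
  then have "coprime (int p) (int (\<Prod>T))"
    by (simp only: coprime_int_iff)
  then have "int p * int (\<Prod>T) dvd m \<longleftrightarrow> int p dvd m \<and> int (\<Prod>T) dvd m"
    by (meson divides_mult dvd_mult_left dvd_mult_right)
  then show ?case
    using insert by simp
qed auto

text \<open>The product contains \<open>p\<close> exactly once, so a second factor \<open>p\<close>
  can only come from \<open>m\<close>.\<close>

lemma prime_square_dvd_prod_primes_iff:
  fixes m :: int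
  assumes T: "finite T" "\<And>q. q \<in> T \<Longrightarrow> prime q" and p: "p \<in> T"
  shows "int p ^ 2 dvd int (\<Prod>T) * m \<longleftrightarrow> int p dvd m"
proof -
  have p0: "p > 0" using T p by (simp add: prime_gt_0_nat)
  have "coprime p (\<Prod>(T - {p}))"
    using T p by (intro prod_coprime_right primes_coprime) auto
  then have cop: "coprime (int p) (int (\<Prod>(T - {p})))"
    by (simp only: coprime_int_iff)
  have "\<Prod>T = p * \<Prod>(T - {p})"
    using T p by (simp add: prod.remove)
  then have "int p ^ 2 dvd int (\<Prod>T) * m \<longleftrightarrow> int p * int p dvd int p * (int (\<Prod>(T - {p})) * m)"
    by (simp add: power2_eq_square mult.assoc)
  also have "\<dots> \<longleftrightarrow> int p dvd int (\<Prod>(T - {p})) * m"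
    using p0 by simp
  also have "\<dots> \<longleftrightarrow> int p dvd m"
    using cop by (simp add: coprime_dvd_mult_right_iff)
  finally show ?thesis .
qed

lemma prod_primes_pos:
  assumes "\<And>q. q \<in> T \<Longrightarrow> prime (q::nat)"
  shows "\<Prod>T > 0"
  using assms by (metis prime_gt_0_nat prod_pos)

text \<open>Writing a = \<open>\<Prod>T\<close> m turns the conditions on p^2 into sieve conditions
  on m. The case U = T serves the constant term, and U = {} the coefficients strictly between the
  constant and the leading one.\<close>

lemma card_multiples:
  assumes "finite T" "\<And>q. q \<in> T \<Longrightarrow> prime q" "U \<subseteq> T"
  shows "card {a. \<bar>a\<bar> \<le> int H \<and> (\<forall>p\<in>T. int p dvd a) \<and> (\<forall>p\<in>U. \<not> int p ^ 2 dvd a)}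
           = card (sifted U (H / \<Prod>T))"
proof -
  let ?A = "{a. \<bar>a\<bar> \<le> int H \<and> (\<forall>p\<in>T. int p dvd a) \<and> (\<forall>p\<in>U. \<not> int p ^ 2 dvd a)}"
  have s0: "real (\<Prod>T) > 0" using prod_primes_pos[of T] assms by (simp only: of_nat_0_less_iff)
  have mem: "int (\<Prod>T) * m \<in> ?A \<longleftrightarrow> m \<in> sifted U (H / \<Prod>T)" for m
  proof -
    have "\<bar>int (\<Prod>T) * m\<bar> \<le> int H \<longleftrightarrow> \<bar>real_of_int (int (\<Prod>T) * m)\<bar> \<le> real H"
      by linarith
    also have "\<dots> \<longleftrightarrow> \<bar>real_of_int m\<bar> \<le> H / \<Prod>T"
      using s0 by (simp add: abs_mult pos_le_divide_eq mult.commute)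
    finally have size: "\<bar>int (\<Prod>T) * m\<bar> \<le> int H \<longleftrightarrow> \<bar>real_of_int m\<bar> \<le> H / \<Prod>T" .
    have "\<forall>p\<in>T. int p dvd int (\<Prod>T) * m"
      using prod_primes_dvd_iff[of T "int (\<Prod>T) * m"] assms by (meson dvd_triv_left)
    moreover have "int p ^ 2 dvd int (\<Prod>T) * m \<longleftrightarrow> int p dvd m" if "p \<in> U" for p
      using that assms by (intro prime_square_dvd_prod_primes_iff) auto
    ultimately show ?thesis
      unfolding sifted_def mem_Collect_eq size by blast
  qed
  have "?A = (\<lambda>m. int (\<Prod>T) * m) ` sifted U (H / \<Prod>T)"
  proof (intro set_eqI iffI)
    fix a assume a: "a \<in> ?A"
    then have "int (\<Prod>T) dvd a" using prod_primes_dvd_iff[of T a] assms by auto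
    then obtain m where "a = int (\<Prod>T) * m" ..
    with a mem show "a \<in> (\<lambda>m. int (\<Prod>T) * m) ` sifted U (H / \<Prod>T)" by blast
  qed (use mem in blast)
  moreover have "inj_on (\<lambda>m. int (\<Prod>T) * m) (sifted U (H / \<Prod>T))"
    using s0 by (intro inj_onI) (metis mult_left_cancel of_nat_eq_0_iff less_irrefl of_nat_0)
  ultimately show ?thesis
    by (simp only: card_image)
qed

section \<open>Coefficient boxes and inclusion-exclusion\<close>

text \<open>A polynomial of degree at most \<open>d\<close> is a vector of d + 1 free coefficients.
  With this bound instead of an exact degree, the top coefficient is one more independent
  coordinate.\<close>

lemma card_polys_coeffs:
  fixes S :: "nat \<Rightarrow> 'a::zero set"
  shows "card {f. degree f \<le> d \<and> (\<forall>i\<le>d. coeff f i \<in> S i)} = (\<Prod>i\<le>d. card (S i))"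
proof -
  have coeff_Poly: "coeff (Poly (map g [0..<Suc d])) i = (if i \<le> d then g i else 0)" for g :: "nat \<Rightarrow> 'a" and i
    by (simp add: nth_default_def less_Suc_eq_le del: upt_Suc)
  have "bij_betw (\<lambda>f. restrict (coeff f) {..d})
          {f. degree f \<le> d \<and> (\<forall>i\<le>d. coeff f i \<in> S i)} (PiE {..d} S)"
  proof (rule bij_betw_byWitness[where f' = "\<lambda>g. Poly (map g [0..<Suc d])"])
    show "\<forall>f\<in>{f. degree f \<le> d \<and> (\<forall>i\<le>d. coeff f i \<in> S i)}.
            Poly (map (restrict (coeff f) {..d}) [0..<Suc d]) = f"
      by (auto intro!: poly_eqI simp: coeff_Poly coeff_eq_0 simp del: upt_Suc coeff_Poly_eq)
    show "\<forall>g\<in>PiE {..d} S. restrict (coeff (Poly (map g [0..<Suc d]))) {..d} = g"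
      by (auto simp: coeff_Poly PiE_iff extensional_def restrict_def fun_eq_iff simp del: upt_Suc coeff_Poly_eq)
    show "(\<lambda>f. restrict (coeff f) {..d}) ` {f. degree f \<le> d \<and> (\<forall>i\<le>d. coeff f i \<in> S i)}
            \<subseteq> PiE {..d} S"
      by (auto split: if_splits)
    show "(\<lambda>g. Poly (map g [0..<Suc d])) ` PiE {..d} S
            \<subseteq> {f. degree f \<le> d \<and> (\<forall>i\<le>d. coeff f i \<in> S i)}"
      by (auto intro!: degree_le simp: coeff_Poly simp del: upt_Suc coeff_Poly_eq)
  qed
  then show ?thesis
    by (simp add: bij_betw_same_card card_PiE)
qed

text \<open>These are the events of the inclusion-exclusion, one for each \<open>p\<close>.
  Primality of \<open>p\<close> is left to the index set.\<close>

definition eisenstein_at :: "nat \<Rightarrow> nat \<Rightarrow> nat \<Rightarrow> int poly set" where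
  "eisenstein_at d H p = {f. degree f = d \<and> (\<forall>i\<le>d. \<bar>coeff f i\<bar> \<le> int H) \<and>
     (\<forall>i<d. int p dvd coeff f i) \<and> \<not> int p ^ 2 dvd coeff f 0 \<and> \<not> int p dvd coeff f d}"

text \<open>By \<open>d \<ge> 1\<close> the constant term is among the coefficients divisible by p,
  and it is nonzero because p^2 does not divide it. This gives the cutoff p \<le> H and a finite
  union.\<close>

lemma eisenstein_polys_eq_Union:
  assumes "d \<ge> 1"
  shows "eisenstein_polys d H = (\<Union>p\<in>{p. prime p \<and> p \<le> H}. eisenstein_at d H p)"
proof (intro set_eqI iffI)
  fix f assume f: "f \<in> eisenstein_polys d H"
  then obtain p :: int where p: "prime p" "\<forall>i<d. p dvd coeff f i"
      "\<not> p ^ 2 dvd coeff f 0" "\<not> p dvd coeff f d"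
    by (auto simp: eisenstein_polys_def eisenstein_def)
  have int_nat: "int (nat p) = p" using p(1) by (simp add: prime_ge_0_int)
  have "p dvd coeff f 0" using p assms by auto
  moreover have "coeff f 0 \<noteq> 0" using p by auto
  ultimately have "p \<le> \<bar>coeff f 0\<bar>" by (simp add: dvd_imp_le_int zdvd_imp_le)
  then have "p \<le> int H" using f by (fastforce simp: eisenstein_polys_def)
  then have "nat p \<in> {p. prime p \<and> p \<le> H}" using p(1) by (simp add: nat_le_iff)
  moreover have "f \<in> eisenstein_at d H (nat p)"
    using f p int_nat by (auto simp: eisenstein_at_def eisenstein_polys_def)
  ultimately show "f \<in> (\<Union>p\<in>{p. prime p \<and> p \<le> H}. eisenstein_at d H p)" by blast
next
  fix f assume "f \<in> (\<Union>p\<in>{p. prime p \<and> p \<le> H}. eisenstein_at d H p)"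
  then obtain p where p: "prime p" "f \<in> eisenstein_at d H p" by auto
  then show "f \<in> eisenstein_polys d H"
    unfolding eisenstein_polys_def eisenstein_def eisenstein_at_def
    by (auto intro!: exI[of _ "int p"])
qed

text \<open>The three factors belong to the constant term, the d - 1 middle coefficients and the
  leading coefficient. The conditions for different primes of \<open>T\<close> combine within each
  coefficient separately.\<close>

lemma card_Inter_eisenstein_at:
  assumes d: "d \<ge> 1" and T: "finite T" "T \<noteq> {}" "\<And>q. q \<in> T \<Longrightarrow> prime q"
  shows "card (\<Inter>p\<in>T. eisenstein_at d H p) =
    card (sifted T (H / \<Prod>T)) * card (sifted {} (H / \<Prod>T)) ^ (d - 1) * card (sifted T H)"
proof -
  define A where "A = {a. \<bar>a\<bar> \<le> int H \<and> (\<forall>p\<in>T. int p dvd a) \<and> (\<forall>p\<in>T. \<not> int p ^ 2 dvd a)}"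
  define M where "M = {a. \<bar>a\<bar> \<le> int H \<and> (\<forall>p\<in>T. int p dvd a) \<and> (\<forall>p\<in>{}. \<not> int p ^ 2 dvd a)}"
  define S where "S i = (if i = 0 then A else if i = d then sifted T H else M)" for i
  have sifted_H: "m \<in> sifted T H \<longleftrightarrow> \<bar>m\<bar> \<le> int H \<and> (\<forall>p\<in>T. \<not> int p dvd m)" for m
    by (simp add: sifted_def) linarith
  have "(\<Inter>p\<in>T. eisenstein_at d H p) = {f. degree f \<le> d \<and> (\<forall>i\<le>d. coeff f i \<in> S i)}"
  proof (intro set_eqI iffI)
    fix f assume "f \<in> (\<Inter>p\<in>T. eisenstein_at d H p)"
    then have f: "f \<in> eisenstein_at d H p" if "p \<in> T" for p using that by auto
    have "coeff f i \<in> S i" if "i \<le> d" for i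
      using f that d T(2) unfolding S_def A_def M_def eisenstein_at_def
      by (auto simp: sifted_H)
    moreover have "degree f \<le> d" using f T(2) by (auto simp: eisenstein_at_def)
    ultimately show "f \<in> {f. degree f \<le> d \<and> (\<forall>i\<le>d. coeff f i \<in> S i)}" by simp
  next
    fix f assume "f \<in> {f. degree f \<le> d \<and> (\<forall>i\<le>d. coeff f i \<in> S i)}"
    then have f: "degree f \<le> d" "\<And>i. i \<le> d \<Longrightarrow> coeff f i \<in> S i" by auto
    have c0: "coeff f 0 \<in> A" using f(2)[of 0] by (simp add: S_def)
    have cd: "coeff f d \<in> sifted T H" using f(2)[of d] d by (simp add: S_def)
    have ci: "coeff f i \<in> M" if "i < d" for i
      using f(2)[of i] that c0 by (auto simp: S_def A_def M_def split: if_splits)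
    \<comment> \<open>Some prime lies in \<open>T\<close> and would divide 0, so the sieve condition
      on the top coefficient forces the exact degree.\<close>
    have "coeff f d \<noteq> 0" using cd T(2) by (auto simp: sifted_def)
    then have "degree f = d" using f(1) le_degree by force
    moreover have "\<bar>coeff f i\<bar> \<le> int H" if "i \<le> d" for i
      using that ci[of i] cd by (cases "i = d") (auto simp: sifted_H M_def)
    ultimately show "f \<in> (\<Inter>p\<in>T. eisenstein_at d H p)"
      using c0 ci cd by (auto simp: eisenstein_at_def sifted_H A_def M_def)
  qed
  then have "card (\<Inter>p\<in>T. eisenstein_at d H p) = (\<Prod>i\<le>d. card (S i))"
    by (simp only: card_polys_coeffs)
  also have "{..d} = insert 0 (insert d {1..<d})" using d by auto
  also have "(\<Prod>i\<in>\<dots>. card (S i)) = card A * (card (sifted T H) * (\<Prod>i\<in>{1..<d}. card (S i)))"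
    using d by (simp add: S_def)
  also have "(\<Prod>i\<in>{1..<d}. card (S i)) = card M ^ (d - 1)"
    by (simp add: S_def)
  finally show ?thesis
    using card_multiples[of T T H] card_multiples[of T "{}" H] T
    by (simp add: A_def M_def)
qed

lemma eisenstein_count_inclusion_exclusion:
  assumes "d \<ge> 1"
  shows "int (eisenstein_count d H) =
    (\<Sum>T | T \<subseteq> {p. prime p \<and> p \<le> H} \<and> T \<noteq> {}.
       (- 1) ^ (card T + 1) * int (card (\<Inter>p\<in>T. eisenstein_at d H p)))"
proof -
  interpret Incl_Excl finite "int \<circ> card"
    by unfold_locales (auto simp: card_Un_disjnt)
  note U = eisenstein_polys_eq_Union[OF assms, of H]
  have "finite (eisenstein_at d H p)" if "p \<in> {p. prime p \<and> p \<le> H}" for p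
    using that U by (intro finite_subset[OF _ finite_eisenstein_polys[of d H]]) blast
  then show ?thesis
    using restricted_indexed[of "{p. prime p \<and> p \<le> H}" "eisenstein_at d H"]
    by (simp add: eisenstein_count_def U)
qed

section \<open>Sums of inverse powers and of products of primes\<close>

text \<open>Telescoping 1/n^2 \<le> 1/(n-1) - 1/n settles k = 2; for larger k a factor 1/H^(k-2) is
  pulled out first. Allowing any finite set beyond \<open>H\<close> lets the bound serve both
  intervals and the set of values \<open>\<Prod>T\<close>.\<close>

lemma sum_inverse_powers_tail:
  fixes A :: "nat set"
  assumes A: "finite A" "\<And>n. n \<in> A \<Longrightarrow> n > H" and H: "H \<ge> 1" and k: "k \<ge> 2"
  shows "(\<Sum>n\<in>A. 1 / real n ^ k) \<le> 1 / real H ^ (k - 1)"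
proof -
  have squares: "(\<Sum>n\<in>{H<..H+N}. 1 / real n ^ 2) \<le> 1 / H - 1 / (H + N)" for N
  proof (induction N)
    case (Suc N)
    define x where "x = real (H + N)"
    have x: "x > 0" using H by (simp add: x_def)
    then have "1 / (x + 1) ^ 2 \<le> 1 / (x * (x + 1))"
      by (intro divide_left_mono) (auto simp: power2_eq_square)
    also have "\<dots> = 1 / x - 1 / (x + 1)"
      using x by (simp add: field_simps)
    finally have "1 / real (Suc (H + N)) ^ 2 \<le> 1 / real (H + N) - 1 / real (Suc (H + N))"
      by (simp add: x_def add.commute)
    moreover have "{H<..H + Suc N} = insert (Suc (H + N)) {H<..H + N}" by auto
    ultimately show ?case using Suc by simp
  qed auto
  obtain N where N: "A \<subseteq> {..N}"
    using A(1) finite_nat_iff_bounded_le by blast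
  have "(\<Sum>n\<in>A. 1 / real n ^ k) \<le> (\<Sum>n\<in>A. 1 / real H ^ (k - 2) * (1 / real n ^ 2))"
  proof (rule sum_mono)
    fix n assume "n \<in> A"
    then have n: "n > H" using A by auto
    have "real H ^ (k - 2) * real n ^ 2 \<le> real n ^ (k - 2) * real n ^ 2"
      using n by (intro mult_right_mono power_mono) auto
    also have "\<dots> = real n ^ k"
      using k by (simp only: le_add_diff_inverse2 flip: power_add)
    finally show "1 / real n ^ k \<le> 1 / real H ^ (k - 2) * (1 / real n ^ 2)"
      using n H by (simp add: divide_simps)
  qed
  also have "\<dots> = 1 / real H ^ (k - 2) * (\<Sum>n\<in>A. 1 / real n ^ 2)"
    by (simp add: sum_distrib_left)
  also have "\<dots> \<le> 1 / real H ^ (k - 2) * (1 / H)"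
  proof (rule mult_left_mono)
    have "(\<Sum>n\<in>A. 1 / real n ^ 2) \<le> (\<Sum>n\<in>{H<..H+N}. 1 / real n ^ 2)"
      using A N by (intro sum_mono2) (auto simp: subset_eq trans_le_add2)
    also have "\<dots> \<le> 1 / H"
      using squares[of N] by (rule order_trans) simp
    finally show "(\<Sum>n\<in>A. 1 / real n ^ 2) \<le> 1 / H" .
  qed simp
  also have "1 / real H ^ (k - 2) * (1 / H) = 1 / real H ^ (k - 1)"
    using k by (simp add: Suc_diff_Suc numeral_2_eq_2 flip: power_Suc2)
  finally show ?thesis .
qed

text \<open>A left inverse of \<open>Prod\<close> on finite sets of primes: it makes reindexing from
  sets to their products injective.\<close>

lemma prime_factors_prod_primes:
  assumes "finite T" "\<And>q. q \<in> T \<Longrightarrow> prime (q::nat)"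
  shows "prime_factors (\<Prod>T) = T"
proof -
  have "\<Prod>T \<noteq> 0" by (metis assms(2) less_irrefl prod_primes_pos)
  moreover have "prime p \<and> p dvd \<Prod>T \<longleftrightarrow> p \<in> T" for p
    using assms prime_dvd_prod_iff[of T p "\<lambda>x. x"] by (metis dvd_refl primes_dvd_imp_eq)
  ultimately show ?thesis
    by (intro set_eqI) (metis in_prime_factors_iff)
qed

text \<open>Expanding \<open>2 ^ card T\<close> as the number of splittings of \<open>\<Prod>T\<close> into two factors turns the
  sum into part of a square.\<close>
lemma sum_two_power_card_le:
  assumes P: "finite P" "\<And>q. q \<in> P \<Longrightarrow> prime (q::nat)"
  shows "(\<Sum>T | T \<subseteq> P \<and> \<Prod>T \<le> H. 2 ^ card T / real (\<Prod>T) ^ k)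
           \<le> (\<Sum>n=1..H. 1 / real n ^ k) ^ 2"
proof -
  define \<T> where "\<T> = {T. T \<subseteq> P \<and> \<Prod>T \<le> H}"
  have fin: "finite T" and prime: "\<And>q. q \<in> T \<Longrightarrow> prime q" if "T \<subseteq> P" for T
    using that P finite_subset by auto
  have fin\<T>: "finite \<T>" using P(1) by (simp add: \<T>_def)
  have split: "\<Prod>T = \<Prod>U * \<Prod>(T - U)" if "T \<in> \<T>" "U \<subseteq> T" for T U
    using that fin[of T] by (simp add: \<T>_def prod.subset_diff mult.commute)
  have pos: "\<Prod>T > 0" if "T \<subseteq> P" for T
    using prod_primes_pos prime[OF that] by blast
  have "(\<Sum>T\<in>\<T>. 2 ^ card T / real (\<Prod>T) ^ k) = (\<Sum>T\<in>\<T>. \<Sum>U\<in>Pow T. 1 / real (\<Prod>T) ^ k)"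
    using fin by (intro sum.cong) (auto simp: \<T>_def card_Pow)
  also have "\<dots> = (\<Sum>(T, U)\<in>Sigma \<T> Pow. 1 / real (\<Prod>T) ^ k)"
    using fin fin\<T> by (intro sum.Sigma) (auto simp: \<T>_def)
  also have "\<dots> \<le> (\<Sum>(a, b)\<in>{1..H} \<times> {1..H}. (1 / real a ^ k) * (1 / real b ^ k))"
  \<comment> \<open>The pair (T, U) is matched with a = \<open>\<Prod>U\<close>, b =
    \<open>\<Prod>(T - U)\<close>, and prime factors recover it from (a, b). Both are at most
    \<open>H\<close>, since they are positive with product \<open>\<Prod>T \<le> H\<close>.
    Unmatched pairs only add nonnegative terms.\<close>
  proof (rule sum_le_included[where i = "\<lambda>(a, b). (prime_factors a \<union> prime_factors b, prime_factors a)"])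
    show "finite (Sigma \<T> Pow)" using fin fin\<T> by (auto simp: \<T>_def)
    show "\<forall>x\<in>Sigma \<T> Pow. \<exists>y\<in>{1..H} \<times> {1..H}.
        (case y of (a, b) \<Rightarrow> (prime_factors a \<union> prime_factors b, prime_factors a)) = x \<and>
        (case x of (T, U) \<Rightarrow> 1 / real (\<Prod>T) ^ k) \<le> (case y of (a, b) \<Rightarrow> (1 / real a ^ k) * (1 / real b ^ k))"
    proof (clarify)
      fix T U assume T: "T \<in> \<T>" and U: "U \<subseteq> T"
      have sub: "T \<subseteq> P" "U \<subseteq> P" "T - U \<subseteq> P" using T U by (auto simp: \<T>_def)
      have eq: "\<Prod>T = \<Prod>U * \<Prod>(T - U)" using split T U .
      have "\<Prod>U * \<Prod>(T - U) \<le> H" using T eq by (simp add: \<T>_def)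
      moreover have "\<Prod>U > 0" "\<Prod>(T - U) > 0" using pos sub by blast+
      ultimately have "(\<Prod>U, \<Prod>(T - U)) \<in> {1..H} \<times> {1..H}"
        by (auto intro: order_trans[rotated])
      moreover have "prime_factors (\<Prod>U) = U" "prime_factors (\<Prod>(T - U)) = T - U"
        using sub fin prime by (intro prime_factors_prod_primes; blast)+
      moreover have "1 / real (\<Prod>T) ^ k \<le> 1 / real (\<Prod>U) ^ k * (1 / real (\<Prod>(T - U)) ^ k)"
        unfolding eq of_nat_mult power_mult_distrib by simp
      ultimately show "\<exists>y\<in>{1..H} \<times> {1..H}.
        (case y of (a, b) \<Rightarrow> (prime_factors a \<union> prime_factors b, prime_factors a)) = (T, U) \<and>
        1 / real (\<Prod>T) ^ k \<le> (case y of (a, b) \<Rightarrow> (1 / real a ^ k) * (1 / real b ^ k))"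
        using U by (intro bexI[of _ "(\<Prod>U, \<Prod>(T - U))"]) auto
    qed
  qed auto
  also have "\<dots> = (\<Sum>n=1..H. 1 / real n ^ k) ^ 2"
    by (simp only: power2_eq_square sum_product sum.cartesian_product)
  finally show ?thesis by (simp add: \<T>_def)
qed

section \<open>Truncating the Euler product\<close>

lemma euler_factor_bounds:
  assumes "d \<ge> 2"
  shows "0 \<le> euler_factor d n" "euler_factor d n \<le> 1" "1 - euler_factor d n \<le> 1 / real n ^ d"
proof -
  have "0 \<le> 1 - euler_factor d n \<and> 1 - euler_factor d n \<le> 1 / real n ^ d \<and> 1 - euler_factor d n \<le> 1"
  proof (cases "prime n")
    case True
    then have n: "real n \<ge> 2" using prime_ge_2_nat by force
    have "(real n - 1) ^ 2 \<le> real n ^ 2" using n by (intro power_mono) auto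
    then have "(real n - 1) ^ 2 / real n ^ (d + 2) \<le> real n ^ 2 / real n ^ (d + 2)"
      by (intro divide_right_mono) auto
    also have "\<dots> = 1 / real n ^ d"
      using n by (simp add: field_simps power_add power2_eq_square)
    finally have "(real n - 1) ^ 2 / real n ^ (d + 2) \<le> 1 / real n ^ d" .
    moreover have "1 / real n ^ d \<le> 1" using n by simp
    ultimately show ?thesis using True by (auto simp: euler_factor_def)
  qed (simp add: euler_factor_def)
  then show "0 \<le> euler_factor d n" "euler_factor d n \<le> 1" "1 - euler_factor d n \<le> 1 / real n ^ d"
    by auto
qed

text \<open>All factors lie in [0, 1], so two finite products differ by at most the sum of the
  differences of their factors. For cutoffs H \<le> N these are the defects at H < n \<le> N, each
  at most 1/n^d. The bound is uniform in N and passes to the limit.\<close>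

lemma prodinf_euler_factor_tail:
  assumes d: "d \<ge> 2" and H: "H \<ge> 1"
  shows "\<bar>(\<Prod>n\<le>H. euler_factor d n) - (\<Prod>n. euler_factor d n)\<bar> \<le> 1 / real H ^ (d - 1)"
proof -
  let ?e = "euler_factor d"
  note e = euler_factor_bounds[OF d]
  have "\<bar>(\<Prod>n\<le>H. ?e n) - (\<Prod>n\<le>N. ?e n)\<bar> \<le> 1 / real H ^ (d - 1)" if "N \<ge> H" for N
  proof -
    \<comment> \<open>Padding with factors 1 gives both products the same index set.\<close>
    have "(\<Prod>n\<le>H. ?e n) = (\<Prod>n\<le>N. if n \<le> H then ?e n else 1)"
      using that by (intro prod.mono_neutral_cong_left) auto
    then have "\<bar>(\<Prod>n\<le>H. ?e n) - (\<Prod>n\<le>N. ?e n)\<bar> \<le> (\<Sum>n\<le>N. \<bar>(if n \<le> H then ?e n else 1) - ?e n\<bar>)"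
      using norm_prod_diff[of "{..N}" "\<lambda>n. if n \<le> H then ?e n else 1" ?e] e(1,2) by simp
    also have "\<dots> = (\<Sum>n\<in>{H<..N}. \<bar>1 - ?e n\<bar>)"
      by (intro sum.mono_neutral_cong_right) auto
    also have "\<dots> \<le> (\<Sum>n\<in>{H<..N}. 1 / real n ^ d)"
      by (intro sum_mono) (use e(2,3) in \<open>simp add: abs_of_nonneg\<close>)
    also have "\<dots> \<le> 1 / real H ^ (d - 1)"
      using d H by (intro sum_inverse_powers_tail) auto
    finally show ?thesis .
  qed
  then have "\<forall>\<^sub>F N in sequentially. \<bar>(\<Prod>n\<le>H. ?e n) - (\<Prod>n\<le>N. ?e n)\<bar> \<le> 1 / real H ^ (d - 1)"
    by (auto simp: eventually_at_top_linorder)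
  moreover have "(\<lambda>N. \<bar>(\<Prod>n\<le>H. ?e n) - (\<Prod>n\<le>N. ?e n)\<bar>) \<longlonglongrightarrow> \<bar>(\<Prod>n\<le>H. ?e n) - (\<Prod>n. ?e n)\<bar>"
    by (intro tendsto_intros convergent_prod_LIMSEQ convergent_prod_euler_factor d)
  ultimately show ?thesis
    by (intro tendsto_upperbound) auto
qed

section \<open>Main term and error for one set of primes\<close>

text \<open>Here \<open>A\<close>, \<open>M\<close> and \<open>B\<close> stand for the counts of
  constant, middle and leading coefficients, \<open>g\<close> for the sieve density and
  \<open>w\<close> for the sieve error. The separate bound \<open>B \<le> 3 * Y\<close> keeps the
  result linear in \<open>w\<close>.\<close>

lemma product_approximation:
  fixes A B M X Y g w :: real
  assumes X: "1 \<le> X" "X \<le> Y" and g: "0 \<le> g" "g \<le> 1" and w: "1 \<le> w"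
    and A: "\<bar>A - 2 * X * g\<bar> \<le> w"
    and M: "0 \<le> M" "\<bar>M - 2 * X\<bar> \<le> 1"
    and B: "0 \<le> B" "B \<le> 3 * Y" "\<bar>B - 2 * Y * g\<bar> \<le> w"
  shows "\<bar>A * M ^ k * B - 2 * X * g * (2 * X) ^ k * (2 * Y * g)\<bar> \<le> (5 + 2 * k) * w * Y * (3 * X) ^ k"
proof -
  define Z where "Z = (3 * X) ^ k"
  have M3: "M \<le> 3 * X" using X M by linarith
  have Mk: "0 \<le> M ^ k" "M ^ k \<le> Z" and Xk: "0 \<le> (2 * X) ^ k" "(2 * X) ^ k \<le> Z" and Z0: "Z \<ge> 0"
    unfolding Z_def using M M3 X by (intro power_mono zero_le_power; linarith)+
  \<comment> \<open>Division by 3X moves both bases into [0, 1], where k-th powers differ by at most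
    k times the difference of the bases.\<close>
  have "\<bar>(M / (3 * X)) ^ k - (2 * X / (3 * X)) ^ k\<bar> \<le> k * \<bar>M / (3 * X) - 2 * X / (3 * X)\<bar>"
    using norm_power_diff[of "M / (3 * X)" "2 * X / (3 * X)" k] M M3 X by simp
  also have "\<bar>M / (3 * X) - 2 * X / (3 * X)\<bar> = \<bar>M - 2 * X\<bar> / (3 * X)"
    unfolding diff_divide_distrib[symmetric] abs_divide using X by simp
  also have "k * \<dots> \<le> k * (1 / (3 * X))"
    using M X by (intro mult_left_mono divide_right_mono) auto
  also have "(M / (3 * X)) ^ k - (2 * X / (3 * X)) ^ k = (M ^ k - (2 * X) ^ k) / Z"
    unfolding Z_def power_divide diff_divide_distrib ..
  finally have "\<bar>M ^ k - (2 * X) ^ k\<bar> \<le> k * (1 / (3 * X)) * Z"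
    using X by (simp add: Z_def abs_divide field_simps)
  then have "2 * X * \<bar>M ^ k - (2 * X) ^ k\<bar> \<le> 2 * X * (k * (1 / (3 * X)) * Z)"
    using X by (intro mult_left_mono) auto
  also have "\<dots> = 2 / 3 * k * Z" using X by simp
  finally have power_diff: "2 * X * \<bar>M ^ k - (2 * X) ^ k\<bar> \<le> 2 / 3 * k * Z" .

  \<comment> \<open>The three approximations are exchanged one at a time. Their costs, in units of w
    Y (3X)^k, are 3, 2k and 2, which gives the constant 5 + 2k.\<close>
  have "A * M ^ k * B - 2 * X * g * (2 * X) ^ k * (2 * Y * g) =
      (A - 2 * X * g) * M ^ k * B + 2 * X * (M ^ k - (2 * X) ^ k) * (g * B)
        + 2 * X * (2 * X) ^ k * g * (B - 2 * Y * g)"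
    by (simp add: algebra_simps)
  then have "\<bar>A * M ^ k * B - 2 * X * g * (2 * X) ^ k * (2 * Y * g)\<bar> \<le>
      \<bar>(A - 2 * X * g) * M ^ k * B\<bar> + \<bar>2 * X * (M ^ k - (2 * X) ^ k) * (g * B)\<bar>
        + \<bar>2 * X * (2 * X) ^ k * g * (B - 2 * Y * g)\<bar>"
    by linarith
  moreover have "\<bar>(A - 2 * X * g) * M ^ k * B\<bar> \<le> w * Z * (3 * Y)"
    unfolding abs_mult using A Mk B X w by (intro mult_mono) auto
  moreover have "\<bar>2 * X * (M ^ k - (2 * X) ^ k) * (g * B)\<bar> \<le> 2 / 3 * k * Z * (1 * (3 * Y))"
  proof -
    have "\<bar>2 * X * (M ^ k - (2 * X) ^ k) * (g * B)\<bar> = 2 * X * \<bar>M ^ k - (2 * X) ^ k\<bar> * (g * B)"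
      using g B X by (simp add: abs_mult)
    also have "\<dots> \<le> 2 / 3 * k * Z * (1 * (3 * Y))"
      using g B X Z0 by (intro mult_mono[OF power_diff mult_mono]) auto
    finally show ?thesis .
  qed
  moreover have "2 / 3 * k * Z * (1 * (3 * Y)) \<le> 2 * k * w * Z * Y"
  proof -
    have "2 * real k * 1 * Z * Y \<le> 2 * real k * w * Z * Y"
      using w Z0 X by (intro mult_right_mono mult_left_mono) auto
    then show ?thesis by (simp add: mult_ac)
  qed
  moreover have "\<bar>2 * X * (2 * X) ^ k * g * (B - 2 * Y * g)\<bar> \<le> 2 * Y * Z * 1 * w"
    unfolding abs_mult using g B X Xk Z0 w by (intro mult_mono) auto
  ultimately have "\<bar>A * M ^ k * B - 2 * X * g * (2 * X) ^ k * (2 * Y * g)\<bar>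
      \<le> w * Z * (3 * Y) + 2 * k * w * Z * Y + 2 * Y * Z * 1 * w"
    by linarith
  then show ?thesis
    by (simp add: Z_def algebra_simps)
qed

text \<open>An instance of \<open>product_approximation\<close> with X = H /
  \<open>\<Prod>T\<close>, Y = H, k = d - 1 and w = \<open>2 ^ card T\<close>. The assumption on
  \<open>\<Prod>T\<close> supplies X \<ge> 1.\<close>

lemma card_Inter_eisenstein_at_approx:
  assumes d: "d \<ge> 1" and T: "finite T" "T \<noteq> {}" "\<And>q. q \<in> T \<Longrightarrow> prime q" and H: "\<Prod>T \<le> H"
  shows "\<bar>real (card (\<Inter>p\<in>T. eisenstein_at d H p))
            - 2 ^ (d + 1) * real H ^ (d + 1) * (\<Prod>p\<in>T. 1 - euler_factor d p)\<bar>
          \<le> (2 * real d + 3) * 3 ^ (d - 1) * real H ^ d * (2 ^ card T / real (\<Prod>T) ^ (d - 1))"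
proof -
  define s where "s = real (\<Prod>T)"
  define X where "X = H / s"
  define g where "g = (\<Prod>p\<in>T. 1 - 1 / real p)"
  have pos: "\<Prod>T > 0" using prod_primes_pos T(3) .
  then have s: "s \<ge> 1" unfolding s_def by linarith
  have H': "s \<le> real H" using H by (simp only: s_def of_nat_le_iff)
  have X: "1 \<le> X" "X \<le> H" using s H' by (auto simp: X_def field_simps mult_le_cancel_left1)
  have factor: "0 \<le> 1 - 1 / real p" "1 - 1 / real p \<le> 1" if "p \<in> T" for p
    using prime_gt_0_nat[OF T(3)[OF that]] by auto
  have g: "0 \<le> g" "g \<le> 1"
    unfolding g_def using factor by (auto intro: prod_nonneg prod_le_1)
  have w: "(1::real) \<le> 2 ^ card T" by simp
  have "card (sifted T H) \<le> card (sifted {} (real H))"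
    by (intro card_mono sifted_mono) auto
  then have B: "real (card (sifted T H)) \<le> 3 * real H"
    using card_sifted_empty[of "real H"] X by linarith
  have X0: "X \<ge> 0" using X by linarith
  have approx: "\<bar>real (card (sifted T X)) * real (card (sifted {} X)) ^ (d - 1) * real (card (sifted T H))
          - 2 * X * g * (2 * X) ^ (d - 1) * (2 * real H * g)\<bar>
        \<le> (5 + 2 * real (d - 1)) * 2 ^ card T * H * (3 * X) ^ (d - 1)"
    by (rule product_approximation[OF X g w])
      (use B card_sifted[of T X] card_sifted[of T "real H"] card_sifted_empty[OF X0] T X0 in \<open>auto simp: g_def\<close>)
  \<comment> \<open>Of the two factors 1 - 1/p, one comes from the constant and one from the leading
    coefficient; 1/p^d comes from the d coefficients divisible by p.\<close>
  have "(\<Prod>p\<in>T. 1 - euler_factor d p) = (\<Prod>p\<in>T. (1 - 1 / real p) ^ 2 / real p ^ d)"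
  proof (rule prod.cong)
    fix p assume "p \<in> T"
    then have p: "prime p" "real p > 0" using T prime_gt_0_nat by auto
    then have "1 - 1 / real p = (real p - 1) / real p" by (simp add: field_simps)
    with p show "1 - euler_factor d p = (1 - 1 / real p) ^ 2 / real p ^ d"
      by (simp add: euler_factor_def power_divide power_add mult.commute power2_eq_square)
  qed simp
  also have "\<dots> = g ^ 2 / s ^ d"
    by (simp add: g_def s_def prod_dividef prod_power_distrib)
  finally have density: "(\<Prod>p\<in>T. 1 - euler_factor d p) = g ^ 2 / s ^ d" .
  have d': "Suc (d - 1) = d" using d by simp
  have "2 * X * g * (2 * X) ^ (d - 1) * (2 * real H * g) = (2 * X) ^ Suc (d - 1) * (2 * real H) * g ^ 2"
    by (simp add: power2_eq_square)
  also have "\<dots> = 2 ^ (d + 1) * real H ^ (d + 1) * (g ^ 2 / s ^ d)"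
    unfolding d' by (simp add: X_def power_mult_distrib power_divide)
  finally have main: "2 * X * g * (2 * X) ^ (d - 1) * (2 * real H * g)
      = 2 ^ (d + 1) * real H ^ (d + 1) * (\<Prod>p\<in>T. 1 - euler_factor d p)"
    by (simp only: density)
  have "H * (3 * X) ^ (d - 1) = 3 ^ (d - 1) * real H ^ Suc (d - 1) / s ^ (d - 1)"
    by (simp add: X_def power_mult_distrib power_divide)
  then have HX: "H * (3 * X) ^ (d - 1) = 3 ^ (d - 1) * real H ^ d / s ^ (d - 1)"
    unfolding d' .
  have "5 + 2 * real (d - 1) = 2 * real d + 3"
    using d by (simp add: of_nat_diff)
  then have err: "(5 + 2 * real (d - 1)) * 2 ^ card T * H * (3 * X) ^ (d - 1)
      = (2 * real d + 3) * 3 ^ (d - 1) * real H ^ d * (2 ^ card T / s ^ (d - 1))"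
    unfolding mult.assoc HX by simp
  show ?thesis
    using approx unfolding main err
    by (simp add: card_Inter_eisenstein_at[OF d T] X_def s_def)
qed

section \<open>Collecting the error terms\<close>

lemma Inter_eisenstein_at_empty:
  assumes d: "d \<ge> 1" and T: "finite T" "T \<noteq> {}" "\<And>q. q \<in> T \<Longrightarrow> prime q" and H: "\<Prod>T > H"
  shows "(\<Inter>p\<in>T. eisenstein_at d H p) = {}"
proof (rule ccontr)
  assume "(\<Inter>p\<in>T. eisenstein_at d H p) \<noteq> {}"
  then obtain f where f: "\<And>p. p \<in> T \<Longrightarrow> f \<in> eisenstein_at d H p" by blast
  then have "\<forall>p\<in>T. int p dvd coeff f 0" using d by (auto simp: eisenstein_at_def)
  then have "int (\<Prod>T) dvd coeff f 0" using prod_primes_dvd_iff T by blast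
  moreover have "coeff f 0 \<noteq> 0" "\<bar>coeff f 0\<bar> \<le> int H" using f T(2) by (auto simp: eisenstein_at_def)
  ultimately have "int (\<Prod>T) \<le> int H" using zdvd_imp_le[of "int (\<Prod>T)" "\<bar>coeff f 0\<bar>"] by simp
  then show False using H by (simp only: of_nat_le_iff not_le)
qed

text \<open>For sets with \<open>\<Prod>T > H\<close> the count vanishes, and the whole error is the
  main term bounded here.\<close>

lemma prod_euler_defect_le:
  assumes d: "d \<ge> 2"
  shows "\<bar>\<Prod>p\<in>T. 1 - euler_factor d p\<bar> \<le> 1 / real (\<Prod>T) ^ d"
proof -
  have "\<bar>\<Prod>p\<in>T. 1 - euler_factor d p\<bar> \<le> (\<Prod>p\<in>T. 1 / real p ^ d)"
    unfolding abs_prod using euler_factor_bounds[OF d] by (intro prod_mono) auto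
  also have "\<dots> = 1 / real (\<Prod>T) ^ d"
    by (simp add: prod_dividef prod_power_distrib)
  finally show ?thesis .
qed

text \<open>The first error term comes from sets with \<open>\<Prod>T \<le> H\<close>; the second
  covers both the sets with larger product and the tail of the Euler product. The dependence on d =
  2 or d > 2 is confined to the size of the power sum.\<close>

lemma eisenstein_count_error:
  assumes d: "d \<ge> 2" and H: "H \<ge> 1"
  shows "\<bar>real (eisenstein_count d H) - rho d * 2 ^ (d + 1) * real H ^ (d + 1)\<bar>
    \<le> (2 * real d + 3) * 3 ^ (d - 1) * (real H ^ d * (\<Sum>n=1..H. 1 / real n ^ (d - 1)) ^ 2)
       + 2 ^ (d + 2) * real H ^ 2"
proof -
  define P where "P = {p. prime p \<and> p \<le> H}"
  define V where "V = 2 ^ (d + 1) * real H ^ (d + 1)"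
  define C where "C = (2 * real d + 3) * 3 ^ (d - 1) * real H ^ d"
  define c where "c T = real (card (\<Inter>p\<in>T. eisenstein_at d H p))" for T
  define x where "x T = (\<Prod>p\<in>T. 1 - euler_factor d p)" for T
  define \<T> where "\<T> = {T. T \<subseteq> P \<and> T \<noteq> {}}"
  have P: "finite P" "\<And>q. q \<in> P \<Longrightarrow> prime q" by (auto simp: P_def)
  have \<T>: "finite T" "T \<noteq> {}" "\<And>q. q \<in> T \<Longrightarrow> prime q" if "T \<in> \<T>" for T
    using that P finite_subset by (auto simp: \<T>_def)
  have fin: "finite \<T>" using P(1) by (simp add: \<T>_def)
  have V0: "V \<ge> 0" by (simp add: V_def)
  have C0: "C \<ge> 0" by (simp add: C_def)

  have "real_of_int (int (eisenstein_count d H)) = (\<Sum>T\<in>\<T>. (- 1) ^ (card T + 1) * c T)"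
    using d unfolding c_def \<T>_def P_def
    by (subst eisenstein_count_inclusion_exclusion) auto
  then have count: "real (eisenstein_count d H) = (\<Sum>T\<in>\<T>. (- 1) ^ (card T + 1) * c T)"
    by simp

  \<comment> \<open>Expanded over subsets of \<open>P\<close>, the truncated product carries the
    signs of inclusion-exclusion up to a global minus sign. The term 1 of the empty set accounts for
    the \<open>1 -\<close> in \<open>rho\<close>.\<close>
  have "(\<Prod>n\<le>H. euler_factor d n) = (\<Prod>p\<in>P. 1 - (1 - euler_factor d p))"
    by (intro prod.mono_neutral_cong_right) (auto simp: P_def euler_factor_def)
  also have "\<dots> = (\<Sum>T\<in>Pow P. (- 1) ^ card T * x T)"
    using P by (subst prod_diff_conv_sum) (auto simp: x_def)
  also have "Pow P = insert {} \<T>" by (auto simp: \<T>_def)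
  also have "(\<Sum>T\<in>\<dots>. (- 1) ^ card T * x T) = 1 + (\<Sum>T\<in>\<T>. (- 1) ^ card T * x T)"
    using fin by (subst sum.insert) (auto simp: \<T>_def x_def)
  finally have density: "V * (1 - (\<Prod>n\<le>H. euler_factor d n)) = (\<Sum>T\<in>\<T>. (- 1) ^ (card T + 1) * (V * x T))"
    by (simp add: sum_negf sum_distrib_left mult.left_commute)

  have "\<bar>real (eisenstein_count d H) - V * (1 - (\<Prod>n\<le>H. euler_factor d n))\<bar> \<le> (\<Sum>T\<in>\<T>. \<bar>c T - V * x T\<bar>)"
    unfolding count density sum_subtractf[symmetric] right_diff_distrib[symmetric]
    by (rule order_trans[OF sum_abs]) (simp add: abs_mult)
  also have "\<dots> = (\<Sum>T\<in>{T\<in>\<T>. \<Prod>T \<le> H}. \<bar>c T - V * x T\<bar>) + (\<Sum>T\<in>{T\<in>\<T>. \<Prod>T > H}. \<bar>c T - V * x T\<bar>)"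
    using fin by (subst sum.union_disjoint[symmetric]) (auto intro!: sum.cong)
  also have "(\<Sum>T\<in>{T\<in>\<T>. \<Prod>T \<le> H}. \<bar>c T - V * x T\<bar>) \<le> C * (\<Sum>n=1..H. 1 / real n ^ (d - 1)) ^ 2"
  proof -
    have "(\<Sum>T\<in>{T\<in>\<T>. \<Prod>T \<le> H}. \<bar>c T - V * x T\<bar>)
        \<le> (\<Sum>T\<in>{T\<in>\<T>. \<Prod>T \<le> H}. C * (2 ^ card T / real (\<Prod>T) ^ (d - 1)))"
      unfolding c_def x_def V_def C_def
      using d \<T> by (intro sum_mono card_Inter_eisenstein_at_approx) auto
    also have "\<dots> \<le> (\<Sum>T | T \<subseteq> P \<and> \<Prod>T \<le> H. C * (2 ^ card T / real (\<Prod>T) ^ (d - 1)))"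
      using P C0 by (intro sum_mono2) (auto simp: \<T>_def intro!: mult_nonneg_nonneg divide_nonneg_nonneg prod_nonneg)
    also have "\<dots> \<le> C * (\<Sum>n=1..H. 1 / real n ^ (d - 1)) ^ 2"
      unfolding sum_distrib_left[symmetric]
      using P C0 by (intro mult_left_mono sum_two_power_card_le) auto
    finally show ?thesis .
  qed
  also have "(\<Sum>T\<in>{T\<in>\<T>. \<Prod>T > H}. \<bar>c T - V * x T\<bar>) \<le> V * (1 / real H ^ (d - 1))"
  proof -
    have "(\<Sum>T\<in>{T\<in>\<T>. \<Prod>T > H}. \<bar>c T - V * x T\<bar>) \<le> (\<Sum>T\<in>{T\<in>\<T>. \<Prod>T > H}. V * (1 / real (\<Prod>T) ^ d))"
    proof (rule sum_mono)
      fix T assume T: "T \<in> {T\<in>\<T>. \<Prod>T > H}"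
      then have "c T = 0"
        unfolding c_def using d \<T> by (subst Inter_eisenstein_at_empty) auto
      then have "\<bar>c T - V * x T\<bar> = V * \<bar>x T\<bar>" using V0 by (simp add: abs_mult)
      also have "\<dots> \<le> V * (1 / real (\<Prod>T) ^ d)"
        unfolding x_def using V0 d by (intro mult_left_mono prod_euler_defect_le)
      finally show "\<bar>c T - V * x T\<bar> \<le> V * (1 / real (\<Prod>T) ^ d)" .
    qed
    also have "\<dots> = V * (\<Sum>T\<in>{T\<in>\<T>. \<Prod>T > H}. 1 / real (\<Prod>T) ^ d)"
      by (simp only: sum_distrib_left)
    \<comment> \<open>Distinct sets of primes have distinct products, so this is a sum over distinct
      integers beyond \<open>H\<close>.\<close>
    also have "(\<Sum>T\<in>{T\<in>\<T>. \<Prod>T > H}. 1 / real (\<Prod>T) ^ d) = (\<Sum>n\<in>Prod ` {T\<in>\<T>. \<Prod>T > H}. 1 / real n ^ d)"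
    proof (rule sum.reindex[symmetric, unfolded comp_def])
      show "inj_on Prod {T\<in>\<T>. \<Prod>T > H}"
        by (rule inj_on_inverseI[where g = prime_factors], rule prime_factors_prod_primes)
          (use \<T> in auto)
    qed
    also have "\<dots> \<le> 1 / real H ^ (d - 1)"
      using fin H d by (intro sum_inverse_powers_tail) auto
    finally show ?thesis using V0 by (simp add: mult_left_mono)
  qed
  finally have truncated: "\<bar>real (eisenstein_count d H) - V * (1 - (\<Prod>n\<le>H. euler_factor d n))\<bar>
      \<le> C * (\<Sum>n=1..H. 1 / real n ^ (d - 1)) ^ 2 + V * (1 / real H ^ (d - 1))"
    by simp
  have "\<bar>V * ((\<Prod>n\<le>H. euler_factor d n) - (\<Prod>n. euler_factor d n))\<bar> \<le> V * (1 / real H ^ (d - 1))"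
    unfolding abs_mult abs_of_nonneg[OF V0] by (rule mult_left_mono[OF prodinf_euler_factor_tail[OF d H] V0])
  moreover have "real (eisenstein_count d H) - rho d * 2 ^ (d + 1) * real H ^ (d + 1) =
      (real (eisenstein_count d H) - V * (1 - (\<Prod>n\<le>H. euler_factor d n)))
        - V * ((\<Prod>n\<le>H. euler_factor d n) - (\<Prod>n. euler_factor d n))"
    by (simp add: rho_def V_def algebra_simps)
  \<comment> \<open>This amount occurs twice, for the large products and for the tail, which yields
    the coefficient 2^(d+2).\<close>
  moreover have "V * (1 / real H ^ (d - 1)) = 2 ^ (d + 1) * real H ^ 2"
  proof -
    have "real H ^ (d + 1) = real H ^ 2 * real H ^ (d - 1)"
      using d by (simp flip: power_add)
    then show ?thesis using H by (simp add: V_def)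
  qed
  ultimately have "\<bar>real (eisenstein_count d H) - rho d * 2 ^ (d + 1) * real H ^ (d + 1)\<bar>
      \<le> C * (\<Sum>n=1..H. 1 / real n ^ (d - 1)) ^ 2 + (2 ^ (d + 1) * real H ^ 2 + 2 ^ (d + 1) * real H ^ 2)"
    using truncated by linarith
  then show ?thesis
    by (simp add: C_def mult.assoc)
qed

section \<open>Growth of the error as H tends to infinity\<close>

text \<open>The difference \<open>harm n - ln n\<close> decreases from its value 1 at n = 1.\<close>

lemma sum_inverse_le_one_plus_ln:
  assumes "H \<ge> 1"
  shows "(\<Sum>n=1..H. 1 / real n) \<le> 1 + ln (real H)"
  using euler_mascheroni_sequence_decreasing[of 1 H] assms
  by (simp add: harm_def inverse_eq_divide)

lemma sum_inverse_powers_le_2: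
  assumes "k \<ge> 2"
  shows "(\<Sum>n=1..H. 1 / real n ^ k) \<le> 2"
proof (cases "H \<ge> 1")
  case True
  then have "{1..H} = insert 1 {2..H}" by auto
  then have "(\<Sum>n=1..H. 1 / real n ^ k) = 1 + (\<Sum>n\<in>{2..H}. 1 / real n ^ k)" by simp
  also have "(\<Sum>n\<in>{2..H}. 1 / real n ^ k) \<le> 1 / real 1 ^ (k - 1)"
    using assms by (intro sum_inverse_powers_tail) auto
  finally show ?thesis by simp
qed auto

theorem theorem2:
  fixes d :: nat
  assumes "d \<ge> 2"
  shows "(\<lambda>H::nat. real (eisenstein_count d H) - rho d * 2 ^ (d + 1) * real H ^ (d + 1))
           \<in> O(\<lambda>H::nat. if d > 2 then real H ^ d else real H ^ 2 * (ln (real H)) ^ 2)"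
proof (rule bigoI)
  define C where "C = (2 * real d + 3) * 3 ^ (d - 1)"
  have C0: "C \<ge> 0" by (simp add: C_def)
  \<comment> \<open>The 4 is the square of the 2 in the bounds 2 (for d > 2) and 2 ln H (for d = 2)
    on the power sum.\<close>
  show "\<forall>\<^sub>F H::nat in at_top. norm (real (eisenstein_count d H) - rho d * 2 ^ (d + 1) * real H ^ (d + 1))
      \<le> (C * 4 + 2 ^ (d + 2)) * norm (if d > 2 then real H ^ d else real H ^ 2 * (ln (real H)) ^ 2)"
    \<comment> \<open>From H \<ge> 3 > e follows ln H \<ge> 1, so 1 + ln H \<le> 2 ln H and, for d =
      2, the stray H^2 is absorbed into H^2 (ln H)^2.\<close>
    using eventually_ge_at_top[of 3]
  proof eventually_elim
    case (elim H)
    define E where "E = (if d > 2 then real H ^ d else real H ^ 2 * (ln (real H)) ^ 2)"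
    have "exp 1 \<le> real H" using exp_le elim by linarith
    then have ln1: "1 \<le> ln (real H)" using elim by (simp add: ln_ge_iff)
    have sum0: "0 \<le> (\<Sum>n=1..H. 1 / real n ^ (d - 1))" by (intro sum_nonneg) simp
    have "real H ^ d * (\<Sum>n=1..H. 1 / real n ^ (d - 1)) ^ 2 \<le> 4 * E \<and> real H ^ 2 \<le> E"
    proof (cases "d > 2")
      case True
      then have "(\<Sum>n=1..H. 1 / real n ^ (d - 1)) ^ 2 \<le> 2 ^ 2"
        using sum0 by (intro power_mono sum_inverse_powers_le_2) auto
      then have "real H ^ d * (\<Sum>n=1..H. 1 / real n ^ (d - 1)) ^ 2 \<le> real H ^ d * 2 ^ 2"
        by (intro mult_left_mono) auto
      moreover have "real H ^ 2 \<le> real H ^ d"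
        using True elim by (intro power_increasing) auto
      ultimately show ?thesis using True by (simp add: E_def mult.commute)
    next
      case False
      then have d: "d = 2" using assms by simp
      have "(\<Sum>n=1..H. 1 / real n) \<le> 2 * ln (real H)"
        using sum_inverse_le_one_plus_ln[of H] ln1 elim by linarith
      then have "(\<Sum>n=1..H. 1 / real n) ^ 2 \<le> (2 * ln (real H)) ^ 2"
        using sum0 d by (intro power_mono) auto
      then have "real H ^ 2 * (\<Sum>n=1..H. 1 / real n) ^ 2 \<le> real H ^ 2 * (2 * ln (real H)) ^ 2"
        by (intro mult_left_mono) auto
      moreover have "real H ^ 2 * 1 \<le> real H ^ 2 * ln (real H) ^ 2"
        using ln1 by (intro mult_left_mono) auto
      ultimately show ?thesis using d by (simp add: E_def power_mult_distrib)
    qed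
    then have "C * (real H ^ d * (\<Sum>n=1..H. 1 / real n ^ (d - 1)) ^ 2) + 2 ^ (d + 2) * real H ^ 2
        \<le> C * (4 * E) + 2 ^ (d + 2) * E"
      using C0 by (intro add_mono mult_left_mono) auto
    moreover have "\<bar>real (eisenstein_count d H) - rho d * 2 ^ (d + 1) * real H ^ (d + 1)\<bar>
        \<le> C * (real H ^ d * (\<Sum>n=1..H. 1 / real n ^ (d - 1)) ^ 2) + 2 ^ (d + 2) * real H ^ 2"
      using eisenstein_count_error[OF assms, of H] elim by (simp add: C_def)
    ultimately have "\<bar>real (eisenstein_count d H) - rho d * 2 ^ (d + 1) * real H ^ (d + 1)\<bar>
        \<le> (C * 4 + 2 ^ (d + 2)) * E"
      by (simp add: algebra_simps)
    also have "\<dots> \<le> (C * 4 + 2 ^ (d + 2)) * norm E"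
      using C0 by (intro mult_left_mono) auto
    finally show ?case
      by (simp only: E_def real_norm_def)
  qed
qed

end
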